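(* Let $n\ge 1$. For every $n$-variable Boolean function $f:\{-1,1\}^n\to\{-1,1\}$, the minimum of $\sum_S |w_S|$ over all integer-coefficient polynomial threshold function representations $p=\sum_{S} w_S\prod_{k\in S}x_k$ of $f$ having length at most $0.75\times 2^n$ is at most $0.75\times 2^{\,n2^{n-3}-2^{n-1}+5n}$. (In particular such representations exist.)
   Context: An $n$-variable Boolean function is a map $f:\{-1,1\}^n\to\{-1,1\}$. A multilinear polynomial $p(x_1,\dots,x_n)=\sum_{S\subseteq\{1,\dots,n\}} w_S\prod_{k\in S}x_k$ is a polynomial threshold function (PTF) representation of $f$ if $f(x)=\operatorname{sgn}(p(x))$ for all $x\in\{-1,1\}^n$; in particular $p(x)\neq 0$ for all such $x$. The length of the representation is the number of monomials with non-zero coefficient, and its weight is $\sum_S|w_S|$. *)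

theory Defs
  imports Complex_Main "HOL-Library.FuncSet"
begin

definition cube :: "nat \<Rightarrow> (nat \<Rightarrow> int) set" where
  "cube n = {1..n} \<rightarrow>\<^sub>E {-1, 1}"

definition boolean_function :: "nat \<Rightarrow> ((nat \<Rightarrow> int) \<Rightarrow> int) \<Rightarrow> bool" where
  "boolean_function n f \<longleftrightarrow> f \<in> cube n \<rightarrow> {-1, 1}"

(* An n-variable multilinear polynomial with integer coefficients is given by its
   coefficients w S for S \<subseteq> {1..n}; values of w on other sets are ignored. *)

definition multilinear :: "nat \<Rightarrow> (nat set \<Rightarrow> int) \<Rightarrow> (nat \<Rightarrow> int) \<Rightarrow> int" where
  "multilinear n w x = (\<Sum>S\<in>Pow {1..n}. w S * (\<Prod>k\<in>S. x k))"

(* If f is a Boolean function, the sign condition forces the polynomial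
   to be non-zero on the cube, since sgn 0 = 0. *)

definition ptf_representation ::
  "nat \<Rightarrow> ((nat \<Rightarrow> int) \<Rightarrow> int) \<Rightarrow> (nat set \<Rightarrow> int) \<Rightarrow> bool" where
  "ptf_representation n f w \<longleftrightarrow> (\<forall>x\<in>cube n. f x = sgn (multilinear n w x))"

definition ptf_length :: "nat \<Rightarrow> (nat set \<Rightarrow> int) \<Rightarrow> nat" where
  "ptf_length n w = card {S \<in> Pow {1..n}. w S \<noteq> 0}"

definition ptf_weight :: "nat \<Rightarrow> (nat set \<Rightarrow> int) \<Rightarrow> int" where
  "ptf_weight n w = (\<Sum>S\<in>Pow {1..n}. \<bar>w S\<bar>)"

end

theory Submission
  imports Defs
begin

text \<open>
  Write \<open>p = p\<^sub>0 + x\<^sub>n p\<^sub>1\<close>, and let \<open>A\<close> and \<open>B\<close> be the sets of points of the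
  \<open>(n-1)\<close>-dimensional cube at which the two restrictions of \<open>f\<close> to \<open>x\<^sub>n = \<plusminus>1\<close> agree and
  disagree. On \<open>A\<close> the sign of \<open>p\<^sub>0\<close> has to be right and \<open>p\<^sub>0\<close> has to dominate \<open>p\<^sub>1\<close>; on
  \<open>B\<close> the roles are exchanged. The smaller of the two sets, of size \<open>m \<le> 2\<^sup>n\<^sup>-\<^sup>2\<close>, is
  served by a polynomial with only \<open>m\<close> monomials, and the other one by a large multiple of a
  function that vanishes on the small set, with up to \<open>2\<^sup>n\<^sup>-\<^sup>1\<close> monomials.

  Instead of Cramer's rule and Hadamard's inequality, the sparse interpolating polynomial comes from
  a recursion on the dimension: interpolation on a set with slices \<open>B\<^sub>1\<close> and \<open>B\<^sub>-\<^sub>1\<close> reduces to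
  interpolation on \<open>B\<^sub>1 \<inter> B\<^sub>-\<^sub>1\<close> and then on \<open>B\<^sub>1 \<union> B\<^sub>-\<^sub>1\<close>, whose cardinalities add up to
  \<open>m\<close>. The resulting integer weight is less than \<open>4\<^sup>m\<close>, which is within the claimed bound.
\<close>

declare One_nat_def [simp del]

section \<open>Splitting off the last variable\<close>

text \<open>Coefficient family of p_0 + x_k p_1, with \<open>w\<close> belonging to p_0 and
  \<open>v\<close> to p_1. It is applied with \<open>k = Suc n\<close> to polynomials in n
  variables.\<close>

definition join_coeffs ::
  "nat \<Rightarrow> (nat set \<Rightarrow> int) \<Rightarrow> (nat set \<Rightarrow> int) \<Rightarrow> nat set \<Rightarrow> int" where
  "join_coeffs k w v S = (if k \<in> S then v (S - {k}) else w S)"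

text \<open>Value, weight and length are all sums over \<open>Pow {1..n}\<close>; this split makes
  weight and length additive under \<open>join_coeffs\<close>.\<close>

lemma sum_Pow_Suc:
  fixes F :: "nat set \<Rightarrow> 'a::comm_monoid_add"
  shows "(\<Sum>S\<in>Pow {1..Suc n}. F S) =
    (\<Sum>S\<in>Pow {1..n}. F S) + (\<Sum>S\<in>Pow {1..n}. F (insert (Suc n) S))"
proof -
  have "{1..Suc n} = insert (Suc n) {1..n}"
    by auto
  then have "Pow {1..Suc n} = Pow {1..n} \<union> insert (Suc n) ` Pow {1..n}"
    by (simp add: Pow_insert)
  moreover have "Pow {1..n} \<inter> insert (Suc n) ` Pow {1..n} = {}"
    by force
  moreover have "inj_on (insert (Suc n)) (Pow {1..n})"
    by (rule inj_onI) (metis Pow_iff atLeastAtMost_iff insert_ident not_less_eq_eq order_refl subsetD)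
  ultimately show ?thesis
    by (simp add: sum.union_disjoint sum.reindex)
qed

lemma join_coeffs_simps:
  assumes "S \<in> Pow {1..n}"
  shows "join_coeffs (Suc n) w v S = w S" "join_coeffs (Suc n) w v (insert (Suc n) S) = v S"
proof -
  have "Suc n \<notin> S"
    using assms by force
  then show "join_coeffs (Suc n) w v S = w S"
    and "join_coeffs (Suc n) w v (insert (Suc n) S) = v S"
    by (auto simp: join_coeffs_def)
qed

lemma multilinear_join_coeffs:
  "multilinear (Suc n) (join_coeffs (Suc n) w v) (x(Suc n := s)) =
    multilinear n w x + s * multilinear n v x"
proof -
  have "(\<Prod>k\<in>S. (x(Suc n := s)) k) = (\<Prod>k\<in>S. x k)"
    and "(\<Prod>k\<in>insert (Suc n) S. (x(Suc n := s)) k) = s * (\<Prod>k\<in>S. x k)"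
    if "S \<in> Pow {1..n}" for S
  proof -
    have S: "finite S" "Suc n \<notin> S"
      using that finite_subset[of S "{1..n}"] by auto
    then show *: "(\<Prod>k\<in>S. (x(Suc n := s)) k) = (\<Prod>k\<in>S. x k)"
      by (intro prod.cong) auto
    show "(\<Prod>k\<in>insert (Suc n) S. (x(Suc n := s)) k) = s * (\<Prod>k\<in>S. x k)"
      using S * by simp
  qed
  then show ?thesis
    by (simp add: multilinear_def sum_Pow_Suc join_coeffs_simps sum_distrib_left ac_simps
        del: fun_upd_apply)
qed

lemma ptf_weight_join_coeffs:
  "ptf_weight (Suc n) (join_coeffs (Suc n) w v) = ptf_weight n w + ptf_weight n v"
  by (simp add: ptf_weight_def sum_Pow_Suc join_coeffs_simps)

lemma ptf_length_eq_sum: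
  "ptf_length n w = (\<Sum>S\<in>Pow {1..n}. of_bool (w S \<noteq> 0))"
  by (simp add: ptf_length_def of_bool_def sum.If_cases Int_def conj_commute)

lemma ptf_length_join_coeffs:
  "ptf_length (Suc n) (join_coeffs (Suc n) w v) = ptf_length n w + ptf_length n v"
  by (simp add: ptf_length_eq_sum sum_Pow_Suc join_coeffs_simps)

lemma ptf_length_le: "ptf_length n w \<le> 2 ^ n"
proof -
  have "ptf_length n w \<le> card (Pow {1..n})"
    unfolding ptf_length_def by (intro card_mono) auto
  then show ?thesis
    by (simp add: card_Pow)
qed

lemma ptf_length_scale_le: "ptf_length n (\<lambda>S. c * w S) \<le> ptf_length n w"
  unfolding ptf_length_def by (intro card_mono) auto

lemma ptf_weight_nonneg: "0 \<le> ptf_weight n w"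
  by (simp add: ptf_weight_def sum_nonneg)

lemma ptf_weight_scale: "ptf_weight n (\<lambda>S. c * w S) = \<bar>c\<bar> * ptf_weight n w"
  by (simp add: ptf_weight_def abs_mult sum_distrib_left)

lemma multilinear_scale: "multilinear n (\<lambda>S. c * w S) x = c * multilinear n w x"
  by (simp add: multilinear_def sum_distrib_left ac_simps)

section \<open>The cube and its two slices\<close>

lemma cube_abs:
  assumes "x \<in> cube n" "k \<in> {1..n}"
  shows "\<bar>x k\<bar> = 1"
proof -
  have "x k \<in> {-1, 1}"
    using assms by (auto simp: cube_def PiE_iff)
  then show ?thesis
    by auto
qed

text \<open>Every monomial is 1 or -1 on the cube. Weight bounds thereby become bounds on values,
  which the domination argument needs.\<close>

lemma abs_multilinear_le:
  assumes "x \<in> cube n"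
  shows "\<bar>multilinear n w x\<bar> \<le> ptf_weight n w"
proof -
  have "\<bar>w S * (\<Prod>k\<in>S. x k)\<bar> = \<bar>w S\<bar>" if "S \<in> Pow {1..n}" for S
  proof -
    have "finite S" "\<forall>k\<in>S. \<bar>x k\<bar> = 1"
      using that cube_abs[OF assms] by (auto intro: finite_subset)
    then have "\<bar>\<Prod>k\<in>S. x k\<bar> = 1"
      by (induction S rule: finite_induct) (auto simp: abs_mult)
    then show ?thesis
      by (simp add: abs_mult)
  qed
  then show ?thesis
    unfolding multilinear_def ptf_weight_def by (intro order.trans[OF sum_abs]) auto
qed

lemma finite_cube: "finite (cube n)"
  by (simp add: cube_def finite_PiE)

lemma card_cube: "card (cube n) = 2 ^ n"
  by (simp add: cube_def card_PiE card_insert_if numeral_2_eq_2)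

lemma cube_0: "cube 0 = {\<lambda>_. undefined}"
  by (simp add: cube_def)

lemma cube_SucE:
  assumes "y \<in> cube (Suc n)"
  obtains x s where "x \<in> cube n" "s = 1 \<or> s = -1" "y = x(Suc n := s)"
proof -
  have *: "{1..Suc n} = insert (Suc n) {1..n}"
    by auto
  obtain x s where "x \<in> {1..n} \<rightarrow>\<^sub>E {-1, 1}" "s \<in> {-1, 1::int}" "y = x(Suc n := s)"
    using assms unfolding cube_def * PiE_insert_eq by auto
  then show ?thesis
    using that by (auto simp: cube_def)
qed

lemma cube_SucI:
  assumes "x \<in> cube n" "s = 1 \<or> s = -1"
  shows "x(Suc n := s) \<in> cube (Suc n)"
proof -
  have "{1..Suc n} = insert (Suc n) {1..n}"
    by auto
  then show ?thesis
    using assms unfolding cube_def by (auto simp: PiE_iff extensional_def)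
qed

text \<open>Points of \<open>cube n\<close> are extensional, hence \<open>undefined\<close> at
  \<open>Suc n\<close>, so overwriting that coordinate loses nothing.\<close>

lemma inj_on_cube_upd: "inj_on (\<lambda>x. x(Suc n := s)) (cube n)"
proof (rule inj_onI)
  fix x y
  assume "x \<in> cube n" "y \<in> cube n" and eq: "x(Suc n := s) = y(Suc n := s)"
  then have "x (Suc n) = y (Suc n)"
    by (auto simp: cube_def PiE_iff extensional_def)
  then show "x = y"
    using eq by (metis fun_upd_triv fun_upd_upd)
qed

lemma card_eq_slices:
  assumes "B \<subseteq> cube (Suc n)"
  shows "card B = card {x \<in> cube n. x(Suc n := 1) \<in> B} + card {x \<in> cube n. x(Suc n := -1) \<in> B}"
    (is "_ = card ?P + card ?M")
proof -
  have B: "B = (\<lambda>x. x(Suc n := 1)) ` ?P \<union> (\<lambda>x. x(Suc n := -1)) ` ?M"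
  proof
    show "B \<subseteq> (\<lambda>x. x(Suc n := 1)) ` ?P \<union> (\<lambda>x. x(Suc n := -1)) ` ?M"
    proof
      fix y
      assume "y \<in> B"
      moreover from this obtain x s
        where "x \<in> cube n" "s = 1 \<or> s = -1" "y = x(Suc n := s)"
        using assms cube_SucE by blast
      ultimately show "y \<in> (\<lambda>x. x(Suc n := 1)) ` ?P \<union> (\<lambda>x. x(Suc n := -1)) ` ?M"
        by blast
    qed
  qed auto
  have disj: "(\<lambda>x. x(Suc n := 1)) ` ?P \<inter> (\<lambda>x. x(Suc n := -1)) ` ?M = {}"
    by (auto dest: fun_cong[where x = "Suc n"])
  have "finite ?P" "finite ?M"
    using finite_cube by auto
  then have "card B = card ((\<lambda>x. x(Suc n := 1)) ` ?P) + card ((\<lambda>x. x(Suc n := -1)) ` ?M)"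
    using card_Un_disjoint[OF finite_imageI finite_imageI disj] by (simp only: B[symmetric])
  moreover have "card ((\<lambda>x. x(Suc n := s)) ` X) = card X" if "X \<subseteq> cube n" for X s
    by (intro card_image inj_on_subset[OF inj_on_cube_upd that])
  ultimately show ?thesis
    by simp
qed

section \<open>Interpolation with integer coefficients\<close>

text \<open>The factor 2^(m-1), m = \<open>card B\<close>, clears the denominators from halving sums
  and differences of slices. Values \<open>g\<close> and bound \<open>K\<close> are arbitrary
  because the recursion leaves the realm of signs. For empty \<open>B\<close> the last factor of the
  weight bound is 0, so even a negative \<open>K\<close> is harmless.\<close>

lemma sparse_interpolation:
  fixes g :: "(nat \<Rightarrow> int) \<Rightarrow> int"
  assumes "B \<subseteq> cube n" "\<And>x. x \<in> B \<Longrightarrow> \<bar>g x\<bar> \<le> K"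
  shows "\<exists>w. ptf_length n w \<le> card B
    \<and> ptf_weight n w \<le> K * 2 ^ (card B - 1) * (2 ^ card B - 1)
    \<and> (\<forall>x\<in>B. multilinear n w x = 2 ^ (card B - 1) * g x)"
  using assms
proof (induction n arbitrary: B g K)
  case 0
  then consider "B = {}" | "B = {\<lambda>_. undefined}"
    by (auto simp: cube_0)
  then show ?case
  proof cases
    case 1
    then show ?thesis
      by (intro exI[of _ "\<lambda>_. 0"]) (simp add: ptf_length_def ptf_weight_def)
  next
    case 2
    have "card {S :: nat set. S = {} \<and> g (\<lambda>_. undefined) \<noteq> 0} \<le> card {{} :: nat set}"
      by (rule card_mono) auto
    with 2 0 show ?thesis
      by (intro exI[of _ "\<lambda>_. g (\<lambda>_. undefined)"])
        (simp add: ptf_length_def ptf_weight_def multilinear_def)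
  qed
next
  case (Suc n)
  define P where "P = {x \<in> cube n. x(Suc n := 1) \<in> B}"
  define M where "M = {x \<in> cube n. x(Suc n := -1) \<in> B}"
  define a b where "a = card (P \<inter> M)" and "b = card (P \<union> M)"
  have PM: "P \<subseteq> cube n" "M \<subseteq> cube n"
    by (auto simp: P_def M_def)
  then have fin: "finite P" "finite M"
    using finite_cube finite_subset by blast+
  \<comment> \<open>Inclusion-exclusion: the two recursive calls, on \<open>P \<inter> M\<close> and
    \<open>P \<union> M\<close>, together use up exactly the allowed number of monomials.\<close>
  have card_B: "card B = a + b"
    using card_eq_slices[OF Suc.prems(1)] card_Un_Int[OF fin] by (simp add: P_def M_def a_def b_def)
  have "a \<le> b"
    unfolding a_def b_def using fin by (intro card_mono) auto
  have g_P: "\<bar>g (x(Suc n := 1))\<bar> \<le> K" if "x \<in> P" for x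
    using that Suc.prems(2) by (auto simp: P_def)
  have g_M: "\<bar>g (x(Suc n := -1))\<bar> \<le> K" if "x \<in> M" for x
    using that Suc.prems(2) by (auto simp: M_def)
  have B_cases: "thesis"
    if "y \<in> B" "\<And>x. x \<in> P \<Longrightarrow> y = x(Suc n := 1) \<Longrightarrow> thesis"
      "\<And>x. x \<in> M \<Longrightarrow> y = x(Suc n := -1) \<Longrightarrow> thesis" for y thesis
  proof -
    have "y \<in> cube (Suc n)"
      using that(1) Suc.prems(1) by blast
    then show thesis
      using that cube_SucE[of y n thesis] by (auto simp: P_def M_def)
  qed
  show ?case
  \<comment> \<open>Separate case because \<open>a - 1\<close> truncates to 0, which would break the
    scale identity \<open>c\<close>. When the slices are disjoint, a polynomial free of the last
    variable suffices.\<close>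
  proof (cases "a = 0")
    case True
    then have disj: "P \<inter> M = {}"
      using fin by (simp add: a_def)
    define h where "h x = (if x \<in> P then g (x(Suc n := 1)) else g (x(Suc n := -1)))" for x
    have "\<bar>h x\<bar> \<le> K" if "x \<in> P \<union> M" for x
      using that g_P g_M by (auto simp: h_def)
    then obtain w where w: "ptf_length n w \<le> b" "ptf_weight n w \<le> K * 2 ^ (b - 1) * (2 ^ b - 1)"
      "\<And>x. x \<in> P \<union> M \<Longrightarrow> multilinear n w x = 2 ^ (b - 1) * h x"
      using Suc.IH[of "P \<union> M" h K] PM unfolding b_def by blast
    let ?w = "join_coeffs (Suc n) w (\<lambda>_. 0)"
    have "ptf_length (Suc n) ?w \<le> card B"
      using w(1) by (simp add: ptf_length_join_coeffs card_B ptf_length_def[of _ "\<lambda>_. 0"])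
    moreover have "ptf_weight (Suc n) ?w \<le> K * 2 ^ (card B - 1) * (2 ^ card B - 1)"
      using w(2) True by (simp add: ptf_weight_join_coeffs card_B ptf_weight_def[of _ "\<lambda>_. 0"])
    moreover have "multilinear (Suc n) ?w y = 2 ^ (card B - 1) * g y" if "y \<in> B" for y
      using that
    proof (rule B_cases)
      fix x
      assume "x \<in> P" "y = x(Suc n := 1)"
      then show ?thesis
        using w(3)[of x] True
        by (simp add: multilinear_join_coeffs card_B h_def multilinear_def[of _ "\<lambda>_. 0"])
    next
      fix x
      assume "x \<in> M" "y = x(Suc n := -1)"
      then show ?thesis
        using w(3)[of x] True disj
        by (auto simp add: multilinear_join_coeffs card_B h_def multilinear_def[of _ "\<lambda>_. 0"])
    qed
    ultimately show ?thesis
      by blast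
  next
    case False
    define ca cb :: int where "ca = 2 ^ (a - 1)" and "cb = 2 ^ (b - 1)"
    have c: "2 ^ (card B - 1) = 2 * ca * cb"
    proof -
      have "card B - 1 = Suc ((a - 1) + (b - 1))"
        using False \<open>a \<le> b\<close> card_B by simp
      then show ?thesis
        by (simp add: ca_def cb_def power_add)
    qed
    have pos: "ca > 0" "cb > 0"
      by (auto simp: ca_def cb_def)
    have "\<bar>g (x(Suc n := 1)) - g (x(Suc n := -1))\<bar> \<le> 2 * K" if "x \<in> P \<inter> M" for x
      using that g_P[of x] g_M[of x] by auto
    then obtain v where v: "ptf_length n v \<le> a" "ptf_weight n v \<le> 2 * K * ca * (2 ^ a - 1)"
      "\<And>x. x \<in> P \<inter> M \<Longrightarrow>
        multilinear n v x = ca * (g (x(Suc n := 1)) - g (x(Suc n := -1)))"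
      using Suc.IH[of "P \<inter> M" "\<lambda>x. g (x(Suc n := 1)) - g (x(Suc n := -1))" "2 * K"] PM
      unfolding a_def ca_def by blast
    \<comment> \<open>Once \<open>v\<close> is fixed, each slice prescribes the other part: h + v on
      \<open>P\<close> and h - v on \<open>M\<close> must be \<open>2 * ca\<close> times the target.
      On \<open>P \<inter> M\<close> the two prescriptions agree by the choice of \<open>v\<close>,
      whence \<open>h_M\<close>.\<close>
    define h where "h x = (if x \<in> P then 2 * ca * g (x(Suc n := 1)) - multilinear n v x
      else 2 * ca * g (x(Suc n := -1)) + multilinear n v x)" for x
    have h_M: "h x = 2 * ca * g (x(Suc n := -1)) + multilinear n v x" if "x \<in> M" for x
      using that v(3)[of x] by (auto simp: h_def algebra_simps)
    have "\<bar>h x\<bar> \<le> 2 * K * ca * 2 ^ a" if "x \<in> P \<union> M" for x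
    proof -
      have "\<bar>multilinear n v x\<bar> \<le> 2 * K * ca * (2 ^ a - 1)"
        using that PM abs_multilinear_le[of x n v] v(2) by fastforce
      moreover have "\<bar>2 * ca * g (x(Suc n := 1))\<bar> \<le> 2 * ca * K" if "x \<in> P"
        using g_P[OF that] pos by (simp add: abs_mult)
      moreover have "\<bar>2 * ca * g (x(Suc n := -1))\<bar> \<le> 2 * ca * K" if "x \<in> M"
        using g_M[OF that] pos by (simp add: abs_mult)
      ultimately show ?thesis
        using that by (auto simp: h_def algebra_simps)
    qed
    then obtain w where w: "ptf_length n w \<le> b"
      "ptf_weight n w \<le> 2 * K * ca * 2 ^ a * cb * (2 ^ b - 1)"
      "\<And>x. x \<in> P \<union> M \<Longrightarrow> multilinear n w x = cb * h x"
      using Suc.IH[of "P \<union> M" h "2 * K * ca * 2 ^ a"] PM unfolding b_def cb_def by blast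
    let ?w = "join_coeffs (Suc n) w (\<lambda>S. cb * v S)"
    have "ptf_length (Suc n) ?w \<le> card B"
      using w(1) v(1) ptf_length_scale_le[of n cb v] by (simp add: ptf_length_join_coeffs card_B)
    moreover have "ptf_weight (Suc n) ?w \<le> K * 2 ^ (card B - 1) * (2 ^ card B - 1)"
    proof -
      have "ptf_weight (Suc n) ?w = ptf_weight n w + cb * ptf_weight n v"
        using pos by (simp add: ptf_weight_join_coeffs ptf_weight_scale)
      also have "\<dots> \<le> 2 * K * ca * 2 ^ a * cb * (2 ^ b - 1) + cb * (2 * K * ca * (2 ^ a - 1))"
        using w(2) v(2) pos by (intro add_mono mult_left_mono) auto
      \<comment> \<open>Since 2^a (2^b - 1) + (2^a - 1) = 2^(a+b) - 1, the bound reproduces itself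
        without slack.\<close>
      also have "\<dots> = K * 2 ^ (card B - 1) * (2 ^ card B - 1)"
        unfolding c by (simp add: card_B power_add algebra_simps)
      finally show ?thesis .
    qed
    moreover have "multilinear (Suc n) ?w y = 2 ^ (card B - 1) * g y" if "y \<in> B" for y
      using that
    proof (rule B_cases)
      fix x
      assume "x \<in> P" "y = x(Suc n := 1)"
      then show ?thesis
        using w(3)[of x] unfolding c
        by (simp add: multilinear_join_coeffs multilinear_scale h_def algebra_simps)
    next
      fix x
      assume "x \<in> M" "y = x(Suc n := -1)"
      then show ?thesis
        using w(3)[of x] h_M[of x] unfolding c
        by (simp add: multilinear_join_coeffs multilinear_scale algebra_simps)
    qed
    ultimately show ?thesis
      by blast
  qed
qed

text \<open>Unnormalised Fourier inversion, one variable at a time: sum and difference of the slices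
  at most double the values, and two weights are added, giving a factor 4 per variable.\<close>

lemma fourier_interpolation:
  fixes h :: "(nat \<Rightarrow> int) \<Rightarrow> int"
  assumes "\<And>x. x \<in> cube n \<Longrightarrow> \<bar>h x\<bar> \<le> K"
  shows "\<exists>w. ptf_weight n w \<le> 4 ^ n * K \<and> (\<forall>x\<in>cube n. multilinear n w x = 2 ^ n * h x)"
  using assms
proof (induction n arbitrary: h K)
  case 0
  then show ?case
    by (intro exI[of _ "\<lambda>_. h (\<lambda>_. undefined)"]) (simp add: cube_0 ptf_weight_def multilinear_def)
next
  case (Suc n)
  have h: "\<bar>h (x(Suc n := s))\<bar> \<le> K" if "x \<in> cube n" "s = 1 \<or> s = -1" for x s
    using Suc.prems cube_SucI that by blast
  have "\<bar>h (x(Suc n := 1)) + h (x(Suc n := -1))\<bar> \<le> 2 * K"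
    and "\<bar>h (x(Suc n := 1)) - h (x(Suc n := -1))\<bar> \<le> 2 * K" if "x \<in> cube n" for x
    using h[OF that, of 1] h[OF that, of "-1"] by auto
  then obtain w v
    where w: "ptf_weight n w \<le> 4 ^ n * (2 * K)"
      "\<And>x. x \<in> cube n \<Longrightarrow>
        multilinear n w x = 2 ^ n * (h (x(Suc n := 1)) + h (x(Suc n := -1)))"
    and v: "ptf_weight n v \<le> 4 ^ n * (2 * K)"
      "\<And>x. x \<in> cube n \<Longrightarrow>
        multilinear n v x = 2 ^ n * (h (x(Suc n := 1)) - h (x(Suc n := -1)))"
    using Suc.IH[of "\<lambda>x. h (x(Suc n := 1)) + h (x(Suc n := -1))" "2 * K"]
      Suc.IH[of "\<lambda>x. h (x(Suc n := 1)) - h (x(Suc n := -1))" "2 * K"] by blast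
  let ?w = "join_coeffs (Suc n) w v"
  have "ptf_weight (Suc n) ?w \<le> 4 ^ Suc n * K"
    using w(1) v(1) by (simp add: ptf_weight_join_coeffs)
  moreover have "multilinear (Suc n) ?w y = 2 ^ Suc n * h y" if y: "y \<in> cube (Suc n)" for y
  proof -
    obtain x s where "x \<in> cube n" "s = 1 \<or> s = -1" "y = x(Suc n := s)"
      using cube_SucE[OF y] .
    then show ?thesis
      using w(2)[of x] v(2)[of x] by (auto simp: multilinear_join_coeffs algebra_simps)
  qed
  ultimately show ?case
    by blast
qed

section \<open>Construction of the threshold representation\<close>

lemma sparse_and_dominating_polynomials:
  fixes e :: "(nat \<Rightarrow> int) \<Rightarrow> int"
  assumes C: "C \<subseteq> cube n" and e: "\<And>x. x \<in> cube n \<Longrightarrow> e x = 1 \<or> e x = -1"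
  obtains u v where
    "ptf_length n u \<le> card C"
    "ptf_weight n u + ptf_weight n v \<le> 2 ^ (2 * card C + 2 * n + 1)"
    "\<And>x. x \<in> C \<Longrightarrow> multilinear n v x = 0 \<and> sgn (multilinear n u x) = e x"
    "\<And>x. x \<in> cube n - C \<Longrightarrow>
      \<bar>multilinear n u x\<bar> < \<bar>multilinear n v x\<bar> \<and> sgn (multilinear n v x) = e x"
proof -
  define m where "m = card C"
  have "\<bar>e x\<bar> \<le> 1" if "x \<in> C" for x
    using e[OF subsetD[OF C that]] by auto
  then obtain u where u: "ptf_length n u \<le> m"
    "ptf_weight n u \<le> 1 * 2 ^ (m - 1) * (2 ^ m - 1)"
    "\<And>x. x \<in> C \<Longrightarrow> multilinear n u x = 2 ^ (m - 1) * e x"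
    using sparse_interpolation[OF C, of e 1] unfolding m_def by blast
  \<comment> \<open>The height \<open>4 ^ m\<close> strictly exceeds the weight of \<open>u\<close>,
    hence all its values on the cube.\<close>
  define h :: "(nat \<Rightarrow> int) \<Rightarrow> int" where "h x = (if x \<in> C then 0 else 4 ^ m * e x)" for x
  have "\<bar>h x\<bar> \<le> 4 ^ m" if "x \<in> cube n" for x
    using e[OF that] by (auto simp: h_def)
  then obtain v where v: "ptf_weight n v \<le> 4 ^ n * 4 ^ m"
    "\<And>x. x \<in> cube n \<Longrightarrow> multilinear n v x = 2 ^ n * h x"
    using fourier_interpolation[of n h "4 ^ m"] by blast
  have u_less: "ptf_weight n u < 4 ^ m"
  proof -
    \<comment> \<open>Dropping the -1 in the exponent costs a factor of at most 2 and also covers m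
      = 0.\<close>
    have "(2::int) ^ (m - 1) * (2 ^ m - 1) \<le> 2 ^ m * (2 ^ m - 1)"
      by (intro mult_right_mono power_increasing) auto
    also have "\<dots> < 2 ^ m * 2 ^ m"
      by simp
    also have "\<dots> = 4 ^ m"
      by (simp flip: power_mult_distrib)
    finally show ?thesis
      using u(2) by simp
  qed
  show thesis
  proof
    show "ptf_length n u \<le> card C"
      using u(1) by (simp add: m_def)
    have "(4::int) ^ m \<le> 4 ^ n * 4 ^ m"
      by simp
    then have "ptf_weight n u + ptf_weight n v \<le> 2 * (4 ^ n * 4 ^ m)"
      using u_less v(1) by linarith
    also have "(4::int) ^ n * 4 ^ m = 2 ^ (2 * m + 2 * n)"
      by (simp add: power_add power_mult)
    finally show "ptf_weight n u + ptf_weight n v \<le> 2 ^ (2 * card C + 2 * n + 1)"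
      by (simp add: m_def power_add)
    show "multilinear n v x = 0 \<and> sgn (multilinear n u x) = e x" if "x \<in> C" for x
      using subsetD[OF C that] that u(3)[of x] v(2)[of x] e[of x] by (auto simp: h_def sgn_mult)
    show "\<bar>multilinear n u x\<bar> < \<bar>multilinear n v x\<bar> \<and> sgn (multilinear n v x) = e x"
      if x: "x \<in> cube n - C" for x
    proof -
      have "multilinear n v x = 2 ^ n * 4 ^ m * e x"
        using v(2)[of x] x by (simp add: h_def)
      moreover have "(4::int) ^ m \<le> 2 ^ n * 4 ^ m"
        by simp
      then have "\<bar>multilinear n u x\<bar> < 2 ^ n * 4 ^ m"
        using abs_multilinear_le[OF DiffD1[OF x], of u] u_less by linarith
      ultimately show ?thesis
        using e[of x] x by (auto simp: sgn_mult)
    qed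
  qed
qed

text \<open>Length is at most 2^n for the dominating part plus half of that for the sparse part.
  Doubling the inequality avoids a fraction when n = 0.\<close>

lemma exists_short_ptf:
  assumes "boolean_function (Suc n) f"
  shows "\<exists>w. ptf_representation (Suc n) f w \<and> 2 * ptf_length (Suc n) w \<le> 3 * 2 ^ n
    \<and> ptf_weight (Suc n) w \<le> 2 ^ (2 ^ n + 2 * n + 1)"
proof -
  define e where "e x = f (x(Suc n := 1))" for x
  define A where "A = {x \<in> cube n. f (x(Suc n := -1)) = e x}"
  have f: "f (x(Suc n := s)) = 1 \<or> f (x(Suc n := s)) = -1"
    if "x \<in> cube n" "s = 1 \<or> s = -1" for x s
    using assms cube_SucI[OF that] by (auto simp: boolean_function_def)
  have e: "e x = 1 \<or> e x = -1" if "x \<in> cube n" for x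
    using f[OF that] by (simp add: e_def)
  have f_minus: "f (x(Suc n := -1)) = (if x \<in> A then e x else - e x)" if "x \<in> cube n" for x
    using f[OF that, of "-1"] e[OF that] that by (auto simp: A_def)
  \<comment> \<open>The joined polynomial takes the values p_0 + p_1 and p_0 - p_1 on the two
    slices, so only these signs matter.\<close>
  have rep: "ptf_representation (Suc n) f (join_coeffs (Suc n) w v)"
    if "\<And>x. x \<in> cube n \<Longrightarrow> sgn (multilinear n w x + multilinear n v x) = e x
      \<and> sgn (multilinear n w x - multilinear n v x) = (if x \<in> A then e x else - e x)" for w v
    unfolding ptf_representation_def
  proof
    fix y
    assume y: "y \<in> cube (Suc n)"
    obtain x s where "x \<in> cube n" "s = 1 \<or> s = -1" "y = x(Suc n := s)"
      using cube_SucE[OF y] .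
    then show "f y = sgn (multilinear (Suc n) (join_coeffs (Suc n) w v) y)"
      using that[of x] f_minus[of x] by (auto simp: multilinear_join_coeffs e_def)
  qed
  have A: "A \<subseteq> cube n"
    by (auto simp: A_def)
  have card: "card A + card (cube n - A) = 2 ^ n"
    using card_Diff_subset[OF finite_subset[OF A finite_cube] A] card_mono[OF finite_cube A]
    by (simp add: card_cube)
  have weight: "s \<le> 2 ^ (2 ^ n + 2 * n + 1)"
    if "s \<le> 2 ^ (2 * card C + 2 * n + 1)" "2 * card C \<le> 2 ^ n" for s :: int and C :: "(nat \<Rightarrow> int) set"
  proof -
    have "(2::int) ^ (2 * card C + 2 * n + 1) \<le> 2 ^ (2 ^ n + 2 * n + 1)"
      using that(2) by (intro power_increasing) auto
    then show ?thesis
      using that(1) by linarith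
  qed
  have sgn_dominated: "sgn (q + p) = sgn q \<and> sgn (q - p) = sgn q \<and>
      sgn (p + q) = sgn q \<and> sgn (p - q) = - sgn q" if "\<bar>p\<bar> < \<bar>q\<bar>" for p q :: int
    using that by (auto simp: sgn_if)
  show ?thesis
  proof (cases "2 * card A \<le> 2 ^ n")
    case True
    obtain u v where uv: "ptf_length n u \<le> card A"
      "ptf_weight n u + ptf_weight n v \<le> 2 ^ (2 * card A + 2 * n + 1)"
      "\<And>x. x \<in> A \<Longrightarrow> multilinear n v x = 0 \<and> sgn (multilinear n u x) = e x"
      "\<And>x. x \<in> cube n - A \<Longrightarrow>
        \<bar>multilinear n u x\<bar> < \<bar>multilinear n v x\<bar> \<and> sgn (multilinear n v x) = e x"
      by (rule sparse_and_dominating_polynomials[where e = e, OF A]) (erule e, rule that)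
    have "ptf_representation (Suc n) f (join_coeffs (Suc n) u v)"
    proof (rule rep)
      fix x
      assume "x \<in> cube n"
      then show "sgn (multilinear n u x + multilinear n v x) = e x
          \<and> sgn (multilinear n u x - multilinear n v x) = (if x \<in> A then e x else - e x)"
        using uv(3)[of x] uv(4)[of x] sgn_dominated[of "multilinear n u x" "multilinear n v x"]
        by auto
    qed
    moreover have "2 * ptf_length (Suc n) (join_coeffs (Suc n) u v) \<le> 3 * 2 ^ n"
      using uv(1) ptf_length_le[of n v] True by (simp add: ptf_length_join_coeffs)
    moreover have "ptf_weight (Suc n) (join_coeffs (Suc n) u v) \<le> 2 ^ (2 ^ n + 2 * n + 1)"
      using weight[OF uv(2) True] by (simp add: ptf_weight_join_coeffs)
    ultimately show ?thesis
      by blast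
  next
    case False
    then have small: "2 * card (cube n - A) \<le> 2 ^ n"
      using card by linarith
    obtain u v where uv: "ptf_length n u \<le> card (cube n - A)"
      "ptf_weight n u + ptf_weight n v \<le> 2 ^ (2 * card (cube n - A) + 2 * n + 1)"
      "\<And>x. x \<in> cube n - A \<Longrightarrow> multilinear n v x = 0 \<and> sgn (multilinear n u x) = e x"
      "\<And>x. x \<in> cube n - (cube n - A) \<Longrightarrow>
        \<bar>multilinear n u x\<bar> < \<bar>multilinear n v x\<bar> \<and> sgn (multilinear n v x) = e x"
      by (rule sparse_and_dominating_polynomials[where e = e, OF Diff_subset]) (erule e, rule that)
    \<comment> \<open>The small set now consists of the points where the slices of \<open>f\<close>
      disagree, so the sparse \<open>u\<close> must multiply the last variable.\<close>
    have "ptf_representation (Suc n) f (join_coeffs (Suc n) v u)"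
    proof (rule rep)
      fix x
      assume "x \<in> cube n"
      then show "sgn (multilinear n v x + multilinear n u x) = e x
          \<and> sgn (multilinear n v x - multilinear n u x) = (if x \<in> A then e x else - e x)"
        using uv(3)[of x] uv(4)[of x] sgn_dominated[of "multilinear n u x" "multilinear n v x"]
        by auto
    qed
    moreover have "2 * ptf_length (Suc n) (join_coeffs (Suc n) v u) \<le> 3 * 2 ^ n"
      using uv(1) ptf_length_le[of n v] small by (simp add: ptf_length_join_coeffs)
    moreover have "ptf_weight (Suc n) (join_coeffs (Suc n) v u) \<le> 2 ^ (2 ^ n + 2 * n + 1)"
      using weight[OF uv(2) small] by (simp add: ptf_weight_join_coeffs)
    ultimately show ?thesis
      by blast
  qed
qed

section \<open>Numerical bound and existence of a minimum\<close>

text \<open>With t = 2^(n-3) the claim becomes (8 - n) t <= 3n: the left side is nonpositive from n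
  = 8 on, and seven cases remain. The left side of the statement is one more than the exponent in
  \<open>exists_short_ptf\<close>.\<close>

lemma exponent_bound:
  assumes "n \<ge> 1"
  shows "(2::real) ^ (n - 1) + 2 * real (n - 1) + 2
    \<le> real n * 2 powr (real n - 3) - 2 powr (real n - 1) + 5 * real n"
proof -
  define t :: real where "t = 2 powr (real n - 3)"
  have t: "t = 2 ^ n / 8"
    by (simp add: t_def powr_diff powr_realpow)
  have half: "2 powr (real n - 1) = 4 * t"
    by (simp add: t powr_diff powr_realpow)
  have pow: "(2::real) ^ (n - 1) = 4 * t"
    using assms by (simp add: t power_diff)
  have "(8 - real n) * t \<le> 3 * real n"
  proof (cases "n \<ge> 8")
    case True
    then have "(8 - real n) * t \<le> 0"
      by (intro mult_nonpos_nonneg) (auto simp: t_def)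
    then show ?thesis
      by (simp add: order.trans)
  next
    case False
    with assms consider "n = 1" | "n = 2" | "n = 3" | "n = 4" | "n = 5" | "n = 6" | "n = 7"
      by linarith
    then show ?thesis
      by cases (auto simp: t)
  qed
  then show ?thesis
    using assms unfolding half pow t_def[symmetric] by (simp add: of_nat_diff algebra_simps)
qed

theorem mainTheorem2:
  fixes n :: nat and f :: "(nat \<Rightarrow> int) \<Rightarrow> int"
  assumes "n \<ge> 1" and "boolean_function n f"
  shows "\<exists>w. is_arg_min (ptf_weight n)
               (\<lambda>w. ptf_representation n f w \<and> real (ptf_length n w) \<le> 0.75 * 2 ^ n) w \<and>
             real_of_int (ptf_weight n w)
               \<le> 0.75 * 2 powr (real n * 2 powr (real n - 3) - 2 powr (real n - 1) + 5 * real n)"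
proof -
  define k where "k = n - 1"
  have n: "n = Suc k"
    using assms(1) by (simp add: k_def)
  define R where "R w \<longleftrightarrow> ptf_representation n f w \<and> real (ptf_length n w) \<le> 0.75 * 2 ^ n" for w
  define E where "E = real n * 2 powr (real n - 3) - 2 powr (real n - 1) + 5 * real n"
  obtain v where v: "ptf_representation n f v" "2 * ptf_length n v \<le> 3 * 2 ^ k"
    "ptf_weight n v \<le> 2 ^ (2 ^ k + 2 * k + 1)"
    using exists_short_ptf[of k f] assms(2) unfolding n by blast
  have "real (2 * ptf_length n v) \<le> real (3 * 2 ^ k)"
    using v(2) by (intro of_nat_mono)
  then have "R v"
    using v(1) by (simp add: R_def n)
  \<comment> \<open>Weights are nonnegative integers, so well-ordering of the naturals yields a
    minimiser.\<close>
  then obtain w where w: "R w" "\<And>y. R y \<Longrightarrow> nat (ptf_weight n w) \<le> nat (ptf_weight n y)"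
    using ex_has_least_nat[of R v "\<lambda>w. nat (ptf_weight n w)"] by blast
  have min: "ptf_weight n w \<le> ptf_weight n y" if "R y" for y
    using w(2)[OF that] ptf_weight_nonneg[of n y] by (simp add: nat_le_eq_zle)
  have "real_of_int (ptf_weight n w) \<le> real_of_int (2 ^ (2 ^ k + 2 * k + 1))"
    using min[OF \<open>R v\<close>] v(3) by linarith
  also have "\<dots> = 2 powr real (2 ^ k + 2 * k + 1)"
    unfolding powr_realpow[OF zero_less_numeral] by simp
  \<comment> \<open>The spare unit in the exponent gives a factor 1/2, which absorbs 0.75.\<close>
  also have "\<dots> \<le> 2 powr (E - 1)"
    using exponent_bound[OF assms(1)] by (intro powr_mono) (auto simp: E_def k_def)
  also have "\<dots> \<le> 0.75 * 2 powr E"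
    by (simp add: powr_diff)
  finally have "real_of_int (ptf_weight n w) \<le> 0.75 * 2 powr E" .
  moreover have "is_arg_min (ptf_weight n) R w"
    using w(1) min by (auto simp: is_arg_min_def not_less)
  ultimately show ?thesis
    unfolding E_def R_def by blast
qed

end
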